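(* Every weighted graph $G=(V,E,w)$ with maximum degree at most $3$ has a bisection of weight at least $\frac{2}{3}w(G)$.
   Context: Graphs are finite and simple. A weighted graph $G=(V,E,w)$ is a graph with a weight function $w:E\to\mathbb{R}_{\ge 0}$; $w(G)=\sum_{e\in E}w(e)$. A bisection of $G$ is a partition $(X,Y)$ of $V$ with $\big||X|-|Y|\big|\le 1$ (for a one-vertex graph one part is empty), and its weight is the total weight of the edges with one endpoint in $X$ and the other in $Y$. *)

theory Defs
  imports Complex_Main
begin

text \<open>A graph is a vertex set with a set of edges, each edge being a two-element set of
  vertices. The edgeless graph on the empty vertex set is not excluded.\<close>

locale finite_simple_graph =
  fixes V :: "'a set" and E :: "'a set set"
  assumes finite_V: "finite V"
    and edges: "e \<in> E \<Longrightarrow> e \<subseteq> V \<and> card e = 2"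

locale weighted_graph = finite_simple_graph V E
  for V :: "'a set" and E :: "'a set set" +
  fixes w :: "'a set \<Rightarrow> real"
  assumes w_nonneg: "e \<in> E \<Longrightarrow> 0 \<le> w e"

definition degree :: "'a set set \<Rightarrow> 'a \<Rightarrow> nat" where
  "degree E v = card {e \<in> E. v \<in> e}"

definition total_weight :: "'a set set \<Rightarrow> ('a set \<Rightarrow> real) \<Rightarrow> real" where
  "total_weight E w = (\<Sum>e\<in>E. w e)"

text \<open>The parts are allowed to be empty, which the one-vertex graph requires.\<close>

definition bisection :: "'a set \<Rightarrow> 'a set \<Rightarrow> 'a set \<Rightarrow> bool" where
  "bisection V X Y \<longleftrightarrow>
     X \<union> Y = V \<and> X \<inter> Y = {} \<and> \<bar>int (card X) - int (card Y)\<bar> \<le> 1"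

definition bisection_weight ::
  "'a set set \<Rightarrow> ('a set \<Rightarrow> real) \<Rightarrow> 'a set \<Rightarrow> 'a set \<Rightarrow> real" where
  "bisection_weight E w X Y = (\<Sum>e | e \<in> E \<and> (\<exists>x\<in>X. \<exists>y\<in>Y. e = {x, y}). w e)"

end

theory Submission
  imports Defs
begin

text \<open>
  Take a proper colouring by four colours whose classes have the same size up to one class with one
  vertex more or less. Merging the four classes in pairs gives three bisections, and every edge is
  cut by exactly two of them, so one of the three has weight at least two thirds. Such a colouring
  exists unless \<open>card V mod 4 = 2\<close>; in that case one colours \<open>V - {z}\<close> with one class \<open>a\<close> larger by
  one and puts \<open>z\<close> opposite to \<open>a\<close> in all three bisections. This loses nothing if the edges from
  \<open>z\<close> to \<open>a\<close> carry at least half of the weight at \<open>z\<close>. So either one heavy neighbour of \<open>z\<close> has to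
  lie in \<open>a\<close>, or two non-adjacent neighbours, which are merged for this purpose. Since a merged
  vertex may have degree four, the equitable colouring theorem of Hajnal and Szemeredi for four
  colours is needed with one exceptional vertex of degree four.
\<close>

section \<open>Equitable colouring with four colours\<close>

text \<open>A relation with degrees counted inside \<open>V\<close> makes it possible to restrict to
  subsets, add an isolated vertex or merge two vertices without building new graphs.
  \<open>t\<close> is the exceptional vertex.\<close>

locale near_subcubic =
  fixes V :: "'a set" and R :: "'a \<Rightarrow> 'a \<Rightarrow> bool" and t :: 'a
  assumes finite_V: "finite V"
    and sym: "R x y \<Longrightarrow> R y x"
    and irrefl: "\<not> R x x"
    and deg: "x \<in> V \<Longrightarrow> card {y \<in> V. R x y} \<le> (if x = t then 4 else 3)"
begin

definition proper :: "('a \<Rightarrow> 'c) \<Rightarrow> bool" where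
  "proper f \<longleftrightarrow> (\<forall>x\<in>V. \<forall>y\<in>V. R x y \<longrightarrow> f x \<noteq> f y)"

definition cls :: "('a \<Rightarrow> 'c) \<Rightarrow> 'c \<Rightarrow> 'a set" where
  "cls f c = {x \<in> V. f x = c}"

definition nbrs :: "('a \<Rightarrow> 'c) \<Rightarrow> 'a \<Rightarrow> 'c \<Rightarrow> 'a set" where
  "nbrs f x c = {y \<in> V. R x y \<and> f y = c}"

definition balanced :: "nat \<Rightarrow> ('a \<Rightarrow> 'c) \<Rightarrow> bool" where
  "balanced k f \<longleftrightarrow> proper f \<and> (\<forall>c. card (cls f c) = k)"

text \<open>\<open>p\<close> is the deficient class and \<open>q\<close> the one with a surplus. The
  form \<open>+ 1 = k\<close> avoids truncated subtraction and forces \<open>k\<close> to be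
  positive.\<close>

definition near :: "nat \<Rightarrow> 'c \<Rightarrow> 'c \<Rightarrow> ('a \<Rightarrow> 'c) \<Rightarrow> bool" where
  "near k p q f \<longleftrightarrow> proper f \<and> p \<noteq> q \<and> card (cls f p) + 1 = k \<and> card (cls f q) = k + 1
     \<and> (\<forall>c. c \<noteq> p \<longrightarrow> c \<noteq> q \<longrightarrow> card (cls f c) = k)"

lemma finite_cls [simp]: "finite (cls f c)"
  and finite_nbrs [simp]: "finite (nbrs f x c)"
  by (simp_all add: cls_def nbrs_def finite_V)

lemma sum_card_nbrs_le:
  assumes "x \<in> V" "finite C"
  shows "(\<Sum>c\<in>C. card (nbrs f x c)) \<le> (if x = t then 4 else 3)"
proof -
  have "(\<Sum>c\<in>C. card (nbrs f x c)) = card (\<Union>c\<in>C. nbrs f x c)"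
    by (rule card_UN_disjoint[symmetric]) (use assms(2) in \<open>auto simp: nbrs_def finite_V\<close>)
  also have "\<dots> \<le> card {y \<in> V. R x y}"
    by (rule card_mono) (auto simp: nbrs_def finite_V)
  finally show ?thesis using deg[OF assms(1)] by linarith
qed

section \<open>Recolouring single vertices\<close>

lemma proper_move:
  assumes "proper f" "nbrs f x b = {}"
  shows "proper (f(x := b))"
  unfolding proper_def
proof (intro ballI impI)
  fix y z assume yz: "y \<in> V" "z \<in> V" "R y z"
  have "f y \<noteq> f z" using assms(1) yz by (simp add: proper_def)
  moreover have "f z \<noteq> b" if "y = x" using assms(2) yz that by (auto simp: nbrs_def)
  moreover have "f y \<noteq> b" if "z = x" using assms(2) yz(1) sym[OF yz(3)] that by (auto simp: nbrs_def)
  moreover have "y \<noteq> z" using yz(3) irrefl by metis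
  ultimately show "(f(x := b)) y \<noteq> (f(x := b)) z" by (metis fun_upd_apply)
qed

lemma cls_move_to: "x \<in> V \<Longrightarrow> cls (f(x := b)) b = insert x (cls f b)"
  by (auto simp: cls_def)

lemma cls_move_from: "f x \<noteq> b \<Longrightarrow> cls (f(x := b)) (f x) = cls f (f x) - {x}"
  unfolding cls_def by (intro set_eqI) simp

lemma cls_move_other: "c \<noteq> b \<Longrightarrow> c \<noteq> f x \<Longrightarrow> cls (f(x := b)) c = cls f c"
  unfolding cls_def by (intro set_eqI) auto

lemma card_cls_move:
  assumes "x \<in> V" "f x \<noteq> b"
  shows "card (cls (f(x := b)) c) =
    (if c = b then card (cls f c) + 1 else if c = f x then card (cls f c) - 1 else card (cls f c))"
proof -
  have "x \<in> cls f (f x)" "x \<notin> cls f b" using assms by (simp_all add: cls_def)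
  then show ?thesis
    using assms by (simp add: cls_move_to cls_move_from cls_move_other)
qed

lemma nearD:
  assumes "near k p q f"
  shows "proper f" "p \<noteq> q" "card (cls f p) = k - 1" "k > 0" "card (cls f q) = k + 1"
    "c \<noteq> p \<Longrightarrow> c \<noteq> q \<Longrightarrow> card (cls f c) = k"
  using assms unfolding near_def by (blast | linarith)+

lemma nearI:
  assumes "proper f" "p \<noteq> q" "card (cls f p) = k - 1" "k > 0" "card (cls f q) = k + 1"
    "\<And>c. c \<noteq> p \<Longrightarrow> c \<noteq> q \<Longrightarrow> card (cls f c) = k"
  shows "near k p q f"
  using assms unfolding near_def by simp

lemma near_balanced:
  assumes "near k p q f" "x \<in> cls f q" "nbrs f x p = {}"
  shows "balanced k (f(x := p))"
proof -
  note n = nearD[OF assms(1)]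
  have x: "x \<in> V" "f x = q" using assms(2) by (auto simp: cls_def)
  have "card (cls (f(x := p)) c) = k" for c
    using n(2-6) x by (simp add: card_cls_move)
  with proper_move[OF n(1) assms(3)] show ?thesis by (simp add: balanced_def)
qed

text \<open>Filling the gap in \<open>p\<close> from \<open>u\<close> hands the deficit on to
  \<open>u\<close> and leaves the surplus in \<open>q\<close>, so shifts can be chained.\<close>

lemma near_shift:
  assumes "near k p q f" "x \<in> cls f u" "nbrs f x p = {}" "u \<noteq> p" "u \<noteq> q"
  shows "near k u q (f(x := p))"
proof -
  note n = nearD[OF assms(1)]
  have x: "x \<in> V" "f x = u" using assms(2) by (auto simp: cls_def)
  show ?thesis
    using n(2-6) x assms(4,5) proper_move[OF n(1) assms(3)]
    by (intro nearI) (simp_all add: card_cls_move)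
qed

lemma sum_incidences:
  assumes "finite A" "finite B"
  shows "(\<Sum>y\<in>B. \<Sum>x | x \<in> A \<and> R y x. (c y :: nat)) = (\<Sum>x\<in>A. \<Sum>y | y \<in> B \<and> R x y. c y)"
proof -
  have "(\<Sum>y\<in>B. \<Sum>x | x \<in> A \<and> R y x. c y) = (\<Sum>x\<in>A. \<Sum>y | y \<in> B \<and> R y x. c y)"
    by (rule sum.swap_restrict[OF assms(2,1)])
  moreover have "{y. y \<in> B \<and> R y x} = {y. y \<in> B \<and> R x y}" for x
    by (auto dest: sym)
  ultimately show ?thesis by simp
qed

lemma cls_nbrs: "{y. y \<in> cls f c \<and> R x y} = nbrs f x c"
  by (auto simp: cls_def nbrs_def)

text \<open>A chain of two shifts: the first takes \<open>y\<close> out of \<open>u\<close>, so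
  \<open>x\<close> still has no neighbour there for the second.\<close>

lemma near_shift_balanced:
  fixes f :: "'a \<Rightarrow> 'c"
  assumes "near k p q f" "y \<in> cls f u" "nbrs f y p = {}" "u \<noteq> p" "u \<noteq> q"
    "x \<in> cls f q" "nbrs f x u = {}"
  shows "\<exists>g. balanced k (g :: 'a \<Rightarrow> 'c)"
proof -
  have y: "f y = u" and x: "f x = q" using assms(2,6) by (auto simp: cls_def)
  have "x \<in> cls (f(y := p)) q" "nbrs (f(y := p)) x u = {}"
    using assms(4-7) x y by (auto simp: cls_def nbrs_def split: if_splits)
  then show ?thesis
    using near_balanced[OF near_shift[OF assms(1-5)]] by blast
qed

text \<open>The only possible conflict of \<open>z\<close> in class \<open>w\<close> is with
  \<open>x\<close>, which has already left for \<open>c\<close>.\<close>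

lemma proper_swap:
  assumes "proper f" "x \<in> cls f w" "f z \<noteq> w" "c \<noteq> w" "nbrs f x c = {}" "nbrs f z w \<subseteq> {x}"
  shows "proper (f(x := c, z := w))"
proof (rule proper_move[OF proper_move[OF assms(1,5)]])
  show "nbrs (f(x := c)) z w = {}"
    using assms(2-6) unfolding nbrs_def by (auto split: if_splits)
qed

lemma card_cls_swap:
  assumes "x \<in> cls f w" "z \<in> V" "f z \<noteq> w" "c \<noteq> w"
  shows "card (cls (f(x := c, z := w)) d) =
    (if d = f z then (if d = c then card (cls f d) else card (cls f d) - 1)
     else if d = c then card (cls f d) + 1 else card (cls f d))"
proof -
  have x: "x \<in> V" "f x = w" using assms(1) by (auto simp: cls_def)
  \<comment> \<open>Class \<open>w\<close> loses \<open>x\<close> and regains \<open>z\<close>; with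
    truncated subtraction this cancels only for a nonempty class.\<close>
  have pos: "card (cls f w) > 0" using assms(1) by (auto simp: card_gt_0_iff)
  have z: "(f(x := c)) z = f z" using x assms(3) by auto
  have "card (cls (f(x := c, z := w)) d) =
    (if d = w then card (cls (f(x := c)) d) + 1 else if d = f z then card (cls (f(x := c)) d) - 1
     else card (cls (f(x := c)) d))"
    using card_cls_move[of z "f(x := c)" w d] assms(2,3) z by simp
  then show ?thesis
    using x assms(3,4) pos by (simp add: card_cls_move)
qed

section \<open>Double counting between classes\<close>

lemma card_le_sum_incidences:
  assumes "finite A" "finite B" "\<And>y. y \<in> B \<Longrightarrow> \<exists>x\<in>A. R y x"
    "\<And>x. x \<in> A \<Longrightarrow> card {y. y \<in> B \<and> R x y} \<le> a + (if x = t then 1 else 0)"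
  shows "card B \<le> a * card A + 1"
proof -
  have "card B = (\<Sum>y\<in>B. 1)" by simp
  also have "\<dots> \<le> (\<Sum>y\<in>B. card {x. x \<in> A \<and> R y x})"
    using assms(1,3) by (intro sum_mono) (auto simp: Suc_le_eq card_gt_0_iff)
  also have "\<dots> = (\<Sum>x\<in>A. card {y. y \<in> B \<and> R x y})"
    using sum_incidences[OF assms(1,2), of "\<lambda>_. 1"] by simp
  also have "\<dots> \<le> (\<Sum>x\<in>A. a + (if x = t then 1 else 0))"
    by (intro sum_mono assms(4))
  also have "\<dots> \<le> a * card A + 1"
    using assms(1) by (simp add: sum.distrib sum.delta)
  finally show ?thesis .
qed

definition charge :: "'a set \<Rightarrow> 'a \<Rightarrow> nat" where
  "charge A y = (if card {x. x \<in> A \<and> R y x} = 1 then 2 else 1)"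

text \<open>Each \<open>y \<in> B\<close> distributes a total charge of at least two to its neighbours in \<open>A\<close>:
  two to a unique neighbour, one to each of several neighbours.\<close>

lemma card_le_sum_charges:
  fixes A :: "'a set"
  assumes "finite A" "finite B" "\<And>y. y \<in> B \<Longrightarrow> \<exists>x\<in>A. R y x" "v \<in> A"
    "\<And>x. x \<in> A \<Longrightarrow> (\<Sum>y | y \<in> B \<and> R x y. charge A y) + (if x = v then 1 else 0) \<le> a + (if x = t then 2 else 0)"
  shows "2 * card B + 1 \<le> a * card A + 2"
proof -
  have "2 * card B = (\<Sum>y\<in>B. 2)" by simp
  also have "\<dots> \<le> (\<Sum>y\<in>B. \<Sum>x | x \<in> A \<and> R y x. charge A y)"
  proof (rule sum_mono)
    fix y assume "y \<in> B"
    then have "card {x. x \<in> A \<and> R y x} > 0"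
      using assms(1,3) by (auto simp: card_gt_0_iff)
    then show "2 \<le> (\<Sum>x | x \<in> A \<and> R y x. charge A y)" by (simp add: charge_def)
  qed
  also have "\<dots> = (\<Sum>x\<in>A. \<Sum>y | y \<in> B \<and> R x y. charge A y)"
    by (rule sum_incidences[OF assms(1,2)])
  \<comment> \<open>The extra unit booked at \<open>v\<close> is the slack of one vertex; it decides
    the later counts, which would otherwise be tight.\<close>
  finally have "2 * card B + 1 \<le> (\<Sum>x\<in>A. (\<Sum>y | y \<in> B \<and> R x y. charge A y) + (if x = v then 1 else 0))"
    using assms(1,4) by (simp add: sum.distrib sum.delta)
  also have "\<dots> \<le> (\<Sum>x\<in>A. a + (if x = t then 2 else 0))"
    by (intro sum_mono assms(5))
  also have "\<dots> \<le> a * card A + 2"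
    using assms(1) by (simp add: sum.distrib sum.delta)
  finally show ?thesis .
qed

section \<open>Repairing a nearly balanced colouring\<close>

lemma deg_split3:
  assumes "x \<in> V" "distinct [a, b, c]"
  shows "card (nbrs f x a) + card (nbrs f x b) + card (nbrs f x c) \<le> 3 + (if x = t then 1 else 0)"
  using sum_card_nbrs_le[OF assms(1), of "{a, b, c}" f] assms(2) by (auto split: if_splits)

lemma card_nbrs_pos: "nbrs f x a \<noteq> {} \<Longrightarrow> card (nbrs f x a) \<ge> 1"
  by (simp add: Suc_le_eq card_gt_0_iff)

lemma nbrs_nonempty_iff: "nbrs f y c \<noteq> {} \<longleftrightarrow> (\<exists>x\<in>cls f c. R y x)"
  by (auto simp: nbrs_def cls_def)

text \<open>The argument of Kierstead and Kostochka: call a class accessible if vertices can be shifted from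
  it, class by class, to the deficient class \<open>p\<close>. If \<open>x\<close> in a class not needed for the other
  shifts is the only neighbour there of some \<open>z\<close> in an inaccessible class, and \<open>x\<close> itself can move
  to another accessible class, then \<open>z\<close> can replace \<open>x\<close>. If this never applies, the total charge is
  too small.\<close>

lemma balance_three_accessible:
  fixes f :: "'a \<Rightarrow> 'c"
  assumes near: "near k p q f" and dist: "distinct [p, q, u, w]"
    and u1: "u1 \<in> cls f u" "nbrs f u1 p = {}"
    and w1: "w1 \<in> cls f w" "nbrs f w1 p = {} \<or> nbrs f w1 u = {}"
    and q: "\<And>y c. y \<in> cls f q \<Longrightarrow> c \<in> {p, u, w} \<Longrightarrow> nbrs f y c \<noteq> {}"
  shows "\<exists>g. balanced k (g :: 'a \<Rightarrow> 'c)"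
proof (rule ccontr)
  assume no: "\<nexists>g. balanced k (g :: 'a \<Rightarrow> 'c)"
  note n = nearD[OF near]
  have ne: "p \<noteq> q" "p \<noteq> u" "p \<noteq> w" "q \<noteq> u" "q \<noteq> w" "u \<noteq> w"
      "q \<noteq> p" "u \<noteq> p" "w \<noteq> p" "u \<noteq> q" "w \<noteq> q" "w \<noteq> u"
    using dist by auto
  \<comment> \<open>Let \<open>z\<close> replace \<open>x\<close> in \<open>w\<close>. If
    \<open>x\<close> moves to \<open>p\<close>, the result is balanced at once; if \<open>x\<close>
    moves to \<open>u\<close>, the surplus passes to \<open>u\<close> and \<open>u1\<close> can
    still move on to \<open>p\<close>.\<close>
  have solo: "nbrs f x p \<noteq> {} \<and> nbrs f x u \<noteq> {}"
    if x: "x \<in> cls f w" and z: "z \<in> cls f q" and xz: "nbrs f z w \<subseteq> {x}" for x z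
  proof (intro conjI notI)
    have zV: "z \<in> V" "f z = q" and xV: "x \<in> V" "f x = w" using x z by (auto simp: cls_def)
    have "f z \<noteq> w" using zV dist by auto
    note sw = proper_swap[OF n(1) x this _ _ xz] and cs = card_cls_swap[OF x zV(1) this]
    show False if "nbrs f x p = {}"
    proof -
      have "balanced k (f(x := p, z := w))"
        unfolding balanced_def using sw[of p] cs[of p] that dist zV n(3-6) by simp
      with no show False by blast
    qed
    show False if "nbrs f x u = {}"
    proof -
      let ?g = "f(x := u, z := w)"
      have g: "near k p u ?g"
        using sw[of u] cs[of u] that ne zV n(3-6) by (intro nearI) simp_all
      have "u1 \<noteq> x" "u1 \<noteq> z" using u1 xV zV dist by (auto simp: cls_def)
      then have u1g: "u1 \<in> cls ?g u" using u1 by (simp add: cls_def)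
      have "nbrs ?g u1 p = {}"
        using u1 dist unfolding nbrs_def by (auto split: if_splits)
      then show False using near_balanced[OF g u1g] no by blast
    qed
  qed
  \<comment> \<open>Since \<open>q\<close> has k + 1 vertices and \<open>w\<close> has k, this reads
    2k + 3 \<le> 2k + 2. The unit of slack sits at \<open>w1\<close>.\<close>
  have "2 * card (cls f q) + 1 \<le> 2 * card (cls f w) + 2"
  proof (rule card_le_sum_charges[where v = w1])
    fix x assume x: "x \<in> cls f w"
    then have xV: "x \<in> V" by (simp add: cls_def)
    let ?c = "charge (cls f w)"
    have S: "{y. y \<in> cls f q \<and> R x y} = nbrs f x q" by (rule cls_nbrs)
    show "(\<Sum>y | y \<in> cls f q \<and> R x y. ?c y) + (if x = w1 then 1 else 0) \<le> 2 + (if x = t then 2 else 0)"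
    \<comment> \<open>Given such a \<open>z\<close>, the neighbours of \<open>x\<close> in
      \<open>p\<close> and \<open>u\<close> leave room for one in \<open>q\<close>, two if
      \<open>x = t\<close>, each with charge at most two.\<close>
    proof (cases "\<exists>z\<in>nbrs f x q. nbrs f z w \<subseteq> {x}")
      case True
      then obtain z where z: "z \<in> cls f q" "nbrs f z w \<subseteq> {x}" by (auto simp: nbrs_def cls_def)
      from solo[OF x z] have ne: "nbrs f x p \<noteq> {}" "nbrs f x u \<noteq> {}" by auto
      then have "x \<noteq> w1" using w1 by auto
      moreover have "card (nbrs f x q) \<le> 1 + (if x = t then 1 else 0)"
        using deg_split3[OF xV, of p u q f] ne[THEN card_nbrs_pos] dist by auto
      moreover have "(\<Sum>y\<in>nbrs f x q. ?c y) \<le> (\<Sum>y\<in>nbrs f x q. 2)" by (intro sum_mono) (simp add: charge_def)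
      ultimately show ?thesis unfolding S by (auto split: if_splits)
    next
      case False
      \<comment> \<open>Without such a \<open>z\<close>, each \<open>y\<close> has two neighbours in
        \<open>w\<close> and one each in \<open>p\<close> and \<open>u\<close>. Degree four forces
        \<open>y = t\<close>, so \<open>x\<close> receives at most one unit in all.\<close>
      have t: "y = t" "card (nbrs f y w) \<noteq> 1" if "y \<in> nbrs f x q" for y
      proof -
        have y: "y \<in> V" "y \<in> cls f q" using that by (auto simp: nbrs_def cls_def)
        have xy: "x \<in> nbrs f y w" using that x sym by (auto simp: nbrs_def cls_def)
        show ne1: "card (nbrs f y w) \<noteq> 1"
        proof
          assume "card (nbrs f y w) = 1"
          then obtain v where "nbrs f y w = {v}" by (auto simp: card_Suc_eq numeral_eq_Suc)
          with xy False that show False by auto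
        qed
        have "card (nbrs f y p) \<ge> 1" "card (nbrs f y u) \<ge> 1" "card (nbrs f y w) \<ge> 1"
          by (rule card_nbrs_pos[OF q[OF y(2)]]; simp)+
        then show "y = t"
          using deg_split3[OF y(1), of p u w f] ne1 dist by (auto split: if_splits)
      qed
      then have sub: "nbrs f x q \<subseteq> {t}" by auto
      have "(\<Sum>y\<in>nbrs f x q. ?c y) \<le> (\<Sum>y\<in>nbrs f x q. 1)"
        using t(2) by (intro sum_mono) (simp add: charge_def cls_nbrs)
      also have "\<dots> \<le> 1" using card_mono[OF _ sub] by simp
      finally show ?thesis unfolding S by auto
    qed
  next
    show "\<exists>x\<in>cls f w. R y x" if "y \<in> cls f q" for y
      using q[OF that, of w] by (simp add: nbrs_nonempty_iff)
  qed (use w1 in auto)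
  then show False using n(5) n(6)[of w] ne by simp
qed

text \<open>The same charging when only \<open>p\<close> and \<open>u\<close> are accessible: the 2k
  + 1 vertices of \<open>q\<close> and \<open>w\<close> charge the k vertices of \<open>u\<close>,
  and 4k + 3 exceeds 4k + 2.\<close>

lemma balance_two_accessible:
  fixes f :: "'a \<Rightarrow> 'c"
  assumes near: "near k p q f" and dist: "distinct [p, q, u, w]"
    and u1: "u1 \<in> cls f u" "nbrs f u1 p = {}"
    and B: "\<And>y c. y \<in> cls f q \<union> cls f w \<Longrightarrow> c \<in> {p, u} \<Longrightarrow> nbrs f y c \<noteq> {}"
  shows "\<exists>g. balanced k (g :: 'a \<Rightarrow> 'c)"
proof (rule ccontr)
  assume no: "\<nexists>g. balanced k (g :: 'a \<Rightarrow> 'c)"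
  note n = nearD[OF near]
  have ne: "p \<noteq> q" "p \<noteq> u" "p \<noteq> w" "q \<noteq> u" "q \<noteq> w" "u \<noteq> w"
      "q \<noteq> p" "u \<noteq> p" "w \<noteq> p" "u \<noteq> q" "w \<noteq> q" "w \<noteq> u"
    using dist by auto
  let ?B = "cls f q \<union> cls f w"
  have solo: "nbrs f x p \<noteq> {}"
    if x: "x \<in> cls f u" and z: "z \<in> ?B" and xz: "nbrs f z u \<subseteq> {x}" for x z
  proof
    assume xp: "nbrs f x p = {}"
    have zV: "z \<in> V" "f z \<noteq> u" and xV: "x \<in> V" "f x = u" using x z dist by (auto simp: cls_def)
    have "p \<noteq> u" using dist by auto
    note sw = proper_swap[OF n(1) x zV(2) this xp xz] and cs = card_cls_swap[OF x zV this]
    let ?g = "f(x := p, z := u)"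
    consider "f z = q" | "f z = w" using z by (auto simp: cls_def)
    then show False
    proof cases
      case 1
      then have "balanced k ?g"
        unfolding balanced_def using sw cs dist n(3-6) by simp
      with no show False by blast
    next
      case 2
      \<comment> \<open>Now \<open>w\<close> is deficient. As nothing balanced exists, each vertex
        of \<open>q\<close> has a neighbour left in \<open>w\<close>; but a vertex of
        \<open>w\<close> sees \<open>p\<close> and \<open>u\<close>, hence at most one vertex of
        \<open>q\<close>, two if it is \<open>t\<close>. So k + 1 \<le> (k - 1) + 1, which is
        absurd.\<close>
      have g: "near k w q ?g"
        using sw cs ne n(3-6) 2 by (intro nearI) simp_all
      have gq: "cls ?g q = cls f q" and gw: "cls ?g w = cls f w - {z}"
        using 2 xV dist by (auto simp: cls_def)
      have "card (cls f q) \<le> 1 * card (cls f w - {z}) + 1"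
      proof (rule card_le_sum_incidences)
        show "\<exists>x\<in>cls f w - {z}. R y x" if "y \<in> cls f q" for y
          using near_balanced[OF g, of y] that no unfolding gw[symmetric] gq nbrs_nonempty_iff[symmetric]
          by blast
        show "card {y. y \<in> cls f q \<and> R v y} \<le> 1 + (if v = t then 1 else 0)"
          if "v \<in> cls f w - {z}" for v
        proof -
          have v: "v \<in> V" "v \<in> ?B" using that by (auto simp: cls_def)
          have "card (nbrs f v p) \<ge> 1" "card (nbrs f v u) \<ge> 1"
            by (rule card_nbrs_pos[OF B[OF v(2)]]; simp)+
          then show ?thesis
            using deg_split3[OF v(1), of p u q f] dist by (auto simp: cls_nbrs)
        qed
      qed auto
      moreover have "card (cls f w - {z}) = k - 1"
        using zV 2 n(6)[of w] dist by (subst card_Diff_singleton) (auto simp: cls_def)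
      ultimately show False using n by simp
    qed
  qed
  have "2 * card ?B + 1 \<le> 4 * card (cls f u) + 2"
  proof (rule card_le_sum_charges[where v = u1])
    fix x assume x: "x \<in> cls f u"
    then have xV: "x \<in> V" by (simp add: cls_def)
    let ?c = "charge (cls f u)"
    let ?S = "{y. y \<in> ?B \<and> R x y}"
    have "?S = nbrs f x q \<union> nbrs f x w" by (auto simp: nbrs_def cls_def)
    then have S: "card ?S = card (nbrs f x q) + card (nbrs f x w)"
      using dist by (simp, subst card_Un_disjoint) (auto simp: nbrs_def finite_V)
    have finS: "finite ?S" by simp
    show "(\<Sum>y | y \<in> ?B \<and> R x y. ?c y) + (if x = u1 then 1 else 0) \<le> 4 + (if x = t then 2 else 0)"
    \<comment> \<open>For \<open>x\<close> other than \<open>t\<close>: a neighbour in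
      \<open>p\<close> leaves at most two in \<open>q\<close> and \<open>w\<close>, with charge at
      most two each. Otherwise \<open>x\<close> can move to \<open>p\<close>, so by
      \<open>solo\<close> all charges are one, and three of them leave a unit for
      \<open>u1\<close>.\<close>
    proof (cases "nbrs f x p = {}")
      case False
      then have "x \<noteq> u1" using u1 by auto
      moreover have "card ?S \<le> 2 + (if x = t then 1 else 0)"
        using deg_split3[OF xV, of p q w f] card_nbrs_pos[OF False] dist S by auto
      moreover have "(\<Sum>y\<in>?S. ?c y) \<le> (\<Sum>y\<in>?S. 2)" by (intro sum_mono) (simp add: charge_def)
      ultimately show ?thesis by (auto split: if_splits)
    next
      case True
      have "card (nbrs f y u) \<noteq> 1" if "y \<in> ?S" for y
      proof
        assume "card (nbrs f y u) = 1"
        then obtain v where "nbrs f y u = {v}" by (auto simp: card_Suc_eq numeral_eq_Suc)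
        moreover have "x \<in> nbrs f y u" using that x sym by (auto simp: nbrs_def cls_def)
        ultimately show False using solo[OF x, of y] that True by auto
      qed
      then have "(\<Sum>y\<in>?S. ?c y) \<le> (\<Sum>y\<in>?S. 1)"
        by (intro sum_mono) (simp add: charge_def cls_nbrs)
      also have "\<dots> \<le> 3 + (if x = t then 1 else 0)"
        using deg_split3[OF xV, of p q w f] dist S by simp
      finally show ?thesis by (auto split: if_splits)
    qed
  next
    show "\<exists>x\<in>cls f u. R y x" if "y \<in> ?B" for y
      using B[OF that, of u] by (simp add: nbrs_nonempty_iff)
  qed (use u1 in auto)
  moreover have "card ?B = 2 * k + 1"
    using n(5) n(6)[of w] dist by (subst card_Un_disjoint) (auto simp: cls_def finite_V)
  ultimately show False using n(6)[of u] ne by simp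
qed

text \<open>A chain of shifts from \<open>q\<close> to \<open>p\<close> repairs the colouring
  directly. If there is none, one, two or three classes including \<open>p\<close> are accessible,
  and each possibility is settled by counting.\<close>

lemma near_imp_balanced:
  fixes f :: "'a \<Rightarrow> 'c"
  assumes near: "near k p q f" and dist: "distinct [p, q, u, w]"
  shows "\<exists>g. balanced k (g :: 'a \<Rightarrow> 'c)"
proof -
  note n = nearD[OF near]
  have ne: "p \<noteq> q" "p \<noteq> u" "p \<noteq> w" "q \<noteq> u" "q \<noteq> w" "u \<noteq> w"
      "q \<noteq> p" "u \<noteq> p" "w \<noteq> p" "u \<noteq> q" "w \<noteq> q" "w \<noteq> u"
    using dist by auto
  let ?m = "\<lambda>a b. \<exists>x\<in>cls f a. nbrs f x b = {}"
  have aux: "\<exists>g. balanced k (g :: 'a \<Rightarrow> 'c)"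
    if d: "distinct [p, q, u, w]" and up: "?m u p" for u w
  proof (cases "?m q p \<or> ?m q u")
    case True
    then show ?thesis
      using near_balanced[OF near] near_shift_balanced[OF near, of _ u] up d by auto
  next
    case False
    obtain u1 where u1: "u1 \<in> cls f u" "nbrs f u1 p = {}" using up by blast
    show ?thesis
    proof (cases "?m w p \<or> ?m w u")
      case wm: True
      then obtain w1 where w1: "w1 \<in> cls f w" "nbrs f w1 p = {} \<or> nbrs f w1 u = {}" by blast
      show ?thesis
      proof (cases "?m q w")
        case True
        then obtain x where x: "x \<in> cls f q" "nbrs f x w = {}" by blast
        from w1(2) show ?thesis
        proof
          assume "nbrs f w1 p = {}"
          then show ?thesis using near_shift_balanced[OF near w1(1) _ _ _ x] d by auto
        next
          assume w1u: "nbrs f w1 u = {}"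
          \<comment> \<open>The chain runs from \<open>q\<close> through \<open>w\<close> and
            \<open>u\<close> to \<open>p\<close>. Once \<open>u1\<close> has filled
            \<open>p\<close>, two shifts remain.\<close>
          let ?g = "f(u1 := p)"
          have g: "near k u q ?g" using near_shift[OF near u1] d by auto
          have u1c: "f u1 = u" using u1 by (simp add: cls_def)
          have "w1 \<in> cls ?g w" "nbrs ?g w1 u = {}" "x \<in> cls ?g q" "nbrs ?g x w = {}"
            using w1 w1u x u1c d by (auto simp: cls_def nbrs_def split: if_splits)
          then show ?thesis using near_shift_balanced[OF g] d by auto
        qed
      next
        case qw: False
        show ?thesis
          by (rule balance_three_accessible[OF near d u1 w1]) (use False qw in auto)
      qed
    next
      case wm: False
      show ?thesis
        by (rule balance_two_accessible[OF near d u1]) (use False wm in auto)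
    qed
  qed
  consider "?m u p" | "?m w p" | "?m q p" | "\<not> ?m u p" "\<not> ?m w p" "\<not> ?m q p" by blast
  then show ?thesis
  proof cases
    case 1
    then show ?thesis using aux dist by blast
  next
    case 2
    then show ?thesis using aux[of w u] dist by auto
  next
    case 3
    then show ?thesis using near_balanced[OF near] by blast
  next
    case 4
    \<comment> \<open>Every vertex outside \<open>p\<close> has a neighbour in \<open>p\<close>, so
      these 3k + 1 vertices would number at most 3(k - 1) + 1.\<close>
    let ?B = "cls f q \<union> cls f u \<union> cls f w"
    have "card ?B \<le> 3 * card (cls f p) + 1"
    proof (rule card_le_sum_incidences)
      show "\<exists>x\<in>cls f p. R y x" if "y \<in> ?B" for y
        using that 4 by (auto simp: nbrs_nonempty_iff[symmetric])
      show "card {y. y \<in> ?B \<and> R x y} \<le> 3 + (if x = t then 1 else 0)" if "x \<in> cls f p" for x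
      proof -
        have "card {y. y \<in> ?B \<and> R x y} \<le> card {y \<in> V. R x y}"
          by (rule card_mono) (auto simp: cls_def finite_V)
        then show ?thesis using deg[of x] that by (auto simp: cls_def split: if_splits)
      qed
    qed auto
    moreover have "card ?B = 3 * k + 1"
    proof -
      have "card ?B = card (cls f q \<union> cls f u) + card (cls f w)"
        using dist by (subst card_Un_disjoint) (auto simp: cls_def finite_V)
      also have "card (cls f q \<union> cls f u) = card (cls f q) + card (cls f u)"
        using dist by (subst card_Un_disjoint) (auto simp: cls_def finite_V)
      finally show ?thesis using n(5) n(6)[of u] n(6)[of w] ne by simp
    qed
    ultimately show ?thesis using n(3,4) by simp
  qed
qed

lemma nearly_balanced_imp_balanced:
  fixes f :: "'a \<Rightarrow> 'c"
  assumes "card (UNIV :: 'c set) = 4" "near k p q f"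
  shows "\<exists>g. balanced k (g :: 'a \<Rightarrow> 'c)"
proof -
  have "p \<noteq> q" using assms(2) by (rule nearD)
  then have "card (UNIV - {p, q} :: 'c set) = 2"
    using assms(1) by (subst card_Diff_subset) auto
  then obtain u w where "UNIV - {p, q} = {u, w}" "u \<noteq> w" by (auto simp: card_2_iff)
  then have "distinct [p, q, u, w]" using \<open>p \<noteq> q\<close> by auto
  with assms(2) show ?thesis by (rule near_imp_balanced)
qed

end

section \<open>Existence of balanced colourings\<close>

lemma equipartition_exists:
  assumes "finite V" "card V = card (UNIV :: 'c set) * k" "finite (UNIV :: 'c set)"
  shows "\<exists>f :: 'a \<Rightarrow> 'c. \<forall>c. card {x \<in> V. f x = c} = k"
proof -
  have "card V = card ((UNIV :: 'c set) \<times> {..<k})"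
    using assms(2) by (simp add: card_cartesian_product)
  then obtain h where h: "bij_betw h V ((UNIV :: 'c set) \<times> {..<k})"
    using finite_same_card_bij assms(1,3) by (metis finite_SigmaI finite_lessThan)
  have "card {x \<in> V. (fst \<circ> h) x = c} = k" for c
  proof -
    have "h ` {x \<in> V. (fst \<circ> h) x = c} = {y \<in> h ` V. fst y = c}" by auto
    also have "\<dots> = {c} \<times> {..<k}" using h by (auto simp: bij_betw_def)
    finally have "h ` {x \<in> V. (fst \<circ> h) x = c} = {c} \<times> {..<k}" .
    moreover have "inj_on h {x \<in> V. (fst \<circ> h) x = c}"
      using h by (auto simp: bij_betw_def intro: inj_on_subset)
    from card_image[OF this]
    have "card (h ` {x \<in> V. (fst \<circ> h) x = c}) = card {x \<in> V. (fst \<circ> h) x = c}" .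
    ultimately have "card {x \<in> V. (fst \<circ> h) x = c} = card ({c} \<times> {..<k})" by simp
    then show ?thesis by (simp add: card_cartesian_product_singleton)
  qed
  then show ?thesis by blast
qed

text \<open>Edges are switched off instead of deleting vertices, so the vertex set and the class
  size \<open>k\<close> stay fixed during the induction.\<close>

definition (in near_subcubic) active :: "'a set \<Rightarrow> 'a \<Rightarrow> 'a \<Rightarrow> bool" where
  "active S x y \<longleftrightarrow> R x y \<and> x \<in> S \<and> y \<in> S"

text \<open>Vertices are activated one at a time, starting with the exceptional one: a newly activated
  vertex has at most three neighbours, so it can be moved to a class containing none of them.\<close>

theorem (in near_subcubic) balanced_colouring_exists:
  assumes four: "card (UNIV :: 'c set) = 4" and V: "card V = 4 * k"
  shows "\<exists>f. balanced k (f :: 'a \<Rightarrow> 'c)"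
proof -
  have loc: "near_subcubic V (active S) t" for S
  proof
    show "card {y \<in> V. active S x y} \<le> (if x = t then 4 else 3)" if "x \<in> V" for x
      by (rule order.trans[OF card_mono deg[OF that]]) (auto simp: finite_V active_def)
  qed (auto simp: finite_V irrefl active_def intro: sym)
  have "finite (UNIV :: 'c set)" using four by (intro card_ge_0_finite) simp
  have "\<exists>f :: 'a \<Rightarrow> 'c. near_subcubic.balanced V (active (insert t S)) k f"
    if "finite S" "S \<subseteq> V - {t}" for S
    using that
  proof (induction S)
    case empty
    interpret E: near_subcubic V "active {t}" t by (rule loc)
    obtain f :: "'a \<Rightarrow> 'c" where "\<forall>c. card {x \<in> V. f x = c} = k"
      using equipartition_exists[OF finite_V, of k] V four \<open>finite UNIV\<close> by metis
    then have "E.balanced k f"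
      using irrefl by (auto simp: E.balanced_def E.proper_def E.cls_def active_def)
    then show ?case by blast
  next
    case (insert x S)
    interpret A: near_subcubic V "active (insert t S)" t by (rule loc)
    interpret B: near_subcubic V "active (insert t (insert x S))" t by (rule loc)
    have x: "x \<in> V" "x \<noteq> t" using insert.prems by auto
    obtain f :: "'a \<Rightarrow> 'c" where f: "A.balanced k f"
      using insert.IH insert.prems by blast
    then have fk: "card (B.cls f c) = k" for c
      unfolding A.balanced_def A.cls_def B.cls_def by simp
    have "\<exists>c. B.nbrs f x c = {}"
    proof (rule ccontr)
      assume "\<nexists>c. B.nbrs f x c = {}"
      then have ne: "B.nbrs f x c \<noteq> {}" for c by blast
      have "(\<Sum>c\<in>(UNIV :: 'c set). 1) \<le> (\<Sum>c\<in>UNIV. card (B.nbrs f x c))"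
        by (intro sum_mono B.card_nbrs_pos ne)
      then show False
        using B.sum_card_nbrs_le[OF x(1) \<open>finite UNIV\<close>, of f] x(2) four by simp
    qed
    then obtain c where c: "B.nbrs f x c = {}" by blast
    \<comment> \<open>The edges added at this stage all meet \<open>x\<close>, so \<open>f\<close>
      can fail to be proper only there, and the new colour \<open>c\<close> avoids all active
      neighbours of \<open>x\<close>.\<close>
    have proper: "B.proper (f(x := c))"
      unfolding B.proper_def
    proof (intro ballI impI)
      fix y z assume yz: "y \<in> V" "z \<in> V" "active (insert t (insert x S)) y z"
      have zy: "active (insert t (insert x S)) z y" and "y \<noteq> z"
        using B.sym[OF yz(3)] B.irrefl[of y] yz(3) by metis+
      have "f y \<noteq> f z" if "y \<noteq> x" "z \<noteq> x"
        using f yz that by (auto simp: A.balanced_def A.proper_def active_def)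
      moreover have "f z \<noteq> c" if "y = x" using c yz(2,3) that unfolding B.nbrs_def by blast
      moreover have "f y \<noteq> c" if "z = x" using c yz(1) zy that unfolding B.nbrs_def by blast
      ultimately show "(f(x := c)) y \<noteq> (f(x := c)) z" using \<open>y \<noteq> z\<close> by auto
    qed
    show ?case
    proof (cases "c = f x")
      case True
      then have "f(x := c) = f" by simp
      then have "B.balanced k f" using proper fk by (simp add: B.balanced_def)
      then show ?thesis by blast
    next
      case False
      have "x \<in> B.cls f (f x)" using x by (simp add: B.cls_def)
      then have "k > 0" using fk[of "f x"] by (auto simp: card_gt_0_iff)
      then have "B.near k (f x) c (f(x := c))"
        using proper False fk by (intro B.nearI) (simp_all add: B.card_cls_move[OF x(1)])
      then show ?thesis using B.nearly_balanced_imp_balanced[OF four] by blast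
    qed
  qed
  from this[of "V - {t}"] obtain f :: "'a \<Rightarrow> 'c"
    where f: "near_subcubic.balanced V (active (insert t (V - {t}))) k f"
    using finite_V by auto
  interpret C: near_subcubic V "active (insert t (V - {t}))" t by (rule loc)
  have "balanced k f"
    using f unfolding C.balanced_def balanced_def C.proper_def proper_def C.cls_def cls_def active_def
    by auto
  then show ?thesis by blast
qed

section \<open>Heavy bisections from colourings\<close>

locale weighted_subcubic = weighted_graph V E w
  for V :: "'a set" and E :: "'a set set" and w :: "'a set \<Rightarrow> real" +
  assumes degree_le: "v \<in> V \<Longrightarrow> degree E v \<le> 3"
begin

definition N :: "'a \<Rightarrow> 'a set" where
  "N v = {x. {v, x} \<in> E}"

lemma N_sym: "x \<in> N v \<longleftrightarrow> v \<in> N x"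
  by (simp add: N_def insert_commute)

lemma N_irrefl: "v \<notin> N v"
  using edges[of "{v}"] by (auto simp: N_def)

lemma N_subset: "N v \<subseteq> V"
  using edges by (auto simp: N_def)

lemma finite_N [simp]: "finite (N v)"
  using N_subset finite_V by (rule finite_subset)

lemma finite_E: "finite E"
  by (rule finite_subset[of _ "Pow V"]) (use edges finite_V in auto)

lemma edgeE:
  assumes "e \<in> E"
  obtains x y where "e = {x, y}" "x \<noteq> y" "x \<in> V" "y \<in> V" "y \<in> N x"
proof -
  from edges[OF assms] obtain x y where "e = {x, y}" "x \<noteq> y" "e \<subseteq> V" by (auto simp: card_2_iff)
  with assms that show ?thesis by (auto simp: N_def)
qed

lemma incident_edges: "{e \<in> E. v \<in> e} = (\<lambda>x. {v, x}) ` N v"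
proof
  show "{e \<in> E. v \<in> e} \<subseteq> (\<lambda>x. {v, x}) ` N v"
  proof
    fix e assume "e \<in> {e \<in> E. v \<in> e}"
    then have e: "e \<in> E" "v \<in> e" by auto
    from e(1) show "e \<in> (\<lambda>x. {v, x}) ` N v"
      by (rule edgeE) (use e in \<open>auto simp: N_def insert_commute\<close>)
  qed
qed (auto simp: N_def)

lemma inj_on_doubleton: "inj_on (\<lambda>x. {v, x}) A"
  by (auto simp: inj_on_def doubleton_eq_iff)

lemma card_N_le: "v \<in> V \<Longrightarrow> card (N v) \<le> 3"
  using degree_le[of v] by (simp add: degree_def incident_edges card_image inj_on_doubleton)

lemma sum_incident: "(\<Sum>e | e \<in> E \<and> v \<in> e. w e) = (\<Sum>x\<in>N v. w {v, x})"
  by (simp add: incident_edges sum.reindex inj_on_doubleton)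

section \<open>Averaging over three bisections\<close>

definition separates :: "'a set \<Rightarrow> 'a set \<Rightarrow> bool" where
  "separates X e \<longleftrightarrow> (\<exists>x\<in>X. \<exists>y\<in>V - X. e = {x, y})"

lemma separates_iff: "x \<in> V \<Longrightarrow> y \<in> V \<Longrightarrow> separates X {x, y} \<longleftrightarrow> (x \<in> X) \<noteq> (y \<in> X)"
  unfolding separates_def by (auto simp: doubleton_eq_iff)

lemma sum_bisection_weight:
  assumes "finite B"
  shows "(\<Sum>b\<in>B. bisection_weight E w (X b) (V - X b))
    = (\<Sum>e\<in>E. w e * card {b \<in> B. separates (X b) e})"
proof -
  have "bisection_weight E w (X b) (V - X b) = (\<Sum>e\<in>E. if separates (X b) e then w e else 0)" for b
    unfolding bisection_weight_def separates_def using finite_E by (simp add: sum.inter_filter)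
  then have "(\<Sum>b\<in>B. bisection_weight E w (X b) (V - X b))
      = (\<Sum>e\<in>E. \<Sum>b\<in>B. if separates (X b) e then w e else 0)"
    by (simp add: sum.swap[of _ E])
  also have "\<dots> = (\<Sum>e\<in>E. w e * card {b \<in> B. separates (X b) e})"
  proof (rule sum.cong[OF refl])
    fix e
    have "(\<Sum>b\<in>B. if separates (X b) e then w e else 0) = (\<Sum>b | b \<in> B \<and> separates (X b) e. w e)"
      by (rule sum.inter_filter[OF assms, symmetric])
    then show "(\<Sum>b\<in>B. if separates (X b) e then w e else 0) = w e * card {b \<in> B. separates (X b) e}"
      by simp
  qed
  finally show ?thesis .
qed

text \<open>Were all three bisections lighter than two thirds, their weights would add up to less
  than twice the total weight.\<close>

lemma heavy_bisection_by_averaging: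
  assumes "card B = 3" "\<And>b. b \<in> B \<Longrightarrow> bisection V (X b) (V - X b)"
    "2 * (\<Sum>e\<in>E. w e) \<le> (\<Sum>e\<in>E. w e * card {b \<in> B. separates (X b) e})"
  shows "\<exists>X Y. bisection V X Y \<and> bisection_weight E w X Y \<ge> 2 / 3 * total_weight E w"
proof (rule ccontr)
  assume no: "\<not> ?thesis"
  have B: "finite B" "B \<noteq> {}" using assms(1) by (auto intro: card_ge_0_finite)
  have "bisection_weight E w (X b) (V - X b) < 2 / 3 * total_weight E w" if "b \<in> B" for b
    using no assms(2)[OF that] by (meson not_le)
  then have "(\<Sum>b\<in>B. bisection_weight E w (X b) (V - X b)) < (\<Sum>b\<in>B. 2 / 3 * total_weight E w)"
    by (rule sum_strict_mono[OF B])
  then show False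
    using assms(1,3) by (simp add: sum_bisection_weight[OF B(1)] total_weight_def)
qed

end

section \<open>Pairing four colours\<close>

lemma card_colours: "card (UNIV :: (bool \<times> bool) set) = 4"
  by (simp add: UNIV_Times_UNIV[symmetric] card_cartesian_product del: UNIV_Times_UNIV)

text \<open>The three ways of pairing the four colours are indexed by the partner \<open>b\<close> of a fixed colour
  \<open>a\<close>.\<close>

lemma card_pairings:
  fixes a c d :: "bool \<times> bool"
  assumes "c \<noteq> d"
  shows "card {b \<in> UNIV - {a}. (c \<in> {a, b}) \<noteq> (d \<in> {a, b})} = 2"
proof -
  consider "c = a" | "d = a" | "c \<noteq> a" "d \<noteq> a" by blast
  then show ?thesis
  proof cases
    case 1
    then have "{b \<in> UNIV - {a}. (c \<in> {a, b}) \<noteq> (d \<in> {a, b})} = UNIV - {c, d}" using assms by auto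
    then show ?thesis using assms card_colours by (simp add: card_Diff_subset)
  next
    case 2
    then have "{b \<in> UNIV - {a}. (c \<in> {a, b}) \<noteq> (d \<in> {a, b})} = UNIV - {c, d}" using assms by auto
    then show ?thesis using assms card_colours by (simp add: card_Diff_subset)
  next
    case 3
    then have "{b \<in> UNIV - {a}. (c \<in> {a, b}) \<noteq> (d \<in> {a, b})} = {c, d}" using assms by auto
    then show ?thesis using assms by simp
  qed
qed

lemma card_pairings_with:
  fixes a c :: "bool \<times> bool"
  shows "card {b \<in> UNIV - {a}. c \<in> {a, b}} = (if c = a then 3 else 1)"
proof (cases "c = a")
  case True
  then have "{b \<in> UNIV - {a}. c \<in> {a, b}} = UNIV - {a}" by auto
  then show ?thesis using True card_colours by (simp add: card_Diff_subset)
next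
  case False
  then have "{b \<in> UNIV - {a}. c \<in> {a, b}} = {c}" by auto
  then show ?thesis using False by simp
qed

context weighted_subcubic
begin

definition proper_on :: "'a set \<Rightarrow> ('a \<Rightarrow> bool \<times> bool) \<Rightarrow> bool" where
  "proper_on W f \<longleftrightarrow> (\<forall>x\<in>W. \<forall>y\<in>W. y \<in> N x \<longrightarrow> f x \<noteq> f y)"

text \<open>The colourings below have at most one class of deviating size. If \<open>m = k\<close>,
  the colour \<open>a\<close> is arbitrary and \<open>undefined\<close> stands in for it.\<close>

definition sizes :: "'a set \<Rightarrow> ('a \<Rightarrow> bool \<times> bool) \<Rightarrow> bool \<times> bool \<Rightarrow> nat \<Rightarrow> nat \<Rightarrow> bool" where
  "sizes W f a m k \<longleftrightarrow> (\<forall>c. card {x \<in> W. f x = c} = (if c = a then m else k))"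

lemma sizesD: "sizes W f a m k \<Longrightarrow> card {x \<in> W. f x = c} = (if c = a then m else k)"
  unfolding sizes_def by blast

lemma card_pair:
  assumes "finite W" "sizes W f a m k" "b \<noteq> a"
  shows "card {x \<in> W. f x \<in> {a, b}} = m + k"
proof -
  have "{x \<in> W. f x \<in> {a, b}} = {x \<in> W. f x = a} \<union> {x \<in> W. f x = b}" by auto
  also have "card \<dots> = card {x \<in> W. f x = a} + card {x \<in> W. f x = b}"
    using assms(1,3) by (intro card_Un_disjoint) auto
  finally show ?thesis using assms(3) by (simp add: sizesD[OF assms(2)])
qed

lemma bisection_if_card:
  assumes "X \<subseteq> V" "\<bar>2 * int (card X) - int (card V)\<bar> \<le> 1"
  shows "bisection V X (V - X)"
proof -
  have "card X \<le> card V" using assms(1) finite_V by (rule card_mono[rotated])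
  moreover have "card (V - X) = card V - card X"
    using assms(1) finite_V by (simp add: card_Diff_subset finite_subset)
  ultimately show ?thesis using assms by (auto simp: bisection_def)
qed

text \<open>The side with colour \<open>a\<close> has \<open>m + k\<close> vertices and the other
  one \<open>2 * k\<close>, so they differ by at most one.\<close>

lemma heavy_bisection_of_colouring:
  assumes "proper_on V f" "sizes V f a m k"
    "card V = m + 3 * k" "\<bar>int m - int k\<bar> \<le> 1"
  shows "\<exists>X Y. bisection V X Y \<and> bisection_weight E w X Y \<ge> 2 / 3 * total_weight E w"
proof (rule heavy_bisection_by_averaging[where B = "UNIV - {a}" and X = "\<lambda>b. {x \<in> V. f x \<in> {a, b}}"])
  show "card (UNIV - {a}) = 3" using card_colours by (simp add: card_Diff_subset)
  show "bisection V {x \<in> V. f x \<in> {a, b}} (V - {x \<in> V. f x \<in> {a, b}})" if "b \<in> UNIV - {a}" for b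
    using card_pair[OF finite_V assms(2), of b] assms(3,4) that by (intro bisection_if_card) auto
  have "card {b \<in> UNIV - {a}. separates {x \<in> V. f x \<in> {a, b}} e} = 2" if e: "e \<in> E" for e
  proof -
    from e obtain x y where xy: "e = {x, y}" "x \<in> V" "y \<in> V" "y \<in> N x" by (rule edgeE)
    then have "f x \<noteq> f y" using assms(1) by (auto simp: proper_on_def)
    from card_pairings[OF this, of a] show ?thesis using xy by (simp add: separates_iff)
  qed
  then show "2 * (\<Sum>e\<in>E. w e)
      \<le> (\<Sum>e\<in>E. w e * card {b \<in> UNIV - {a}. separates {x \<in> V. f x \<in> {a, b}} e})"
    by (simp add: sum_distrib_right[symmetric])
qed

text \<open>If \<open>z\<close> always goes to the side avoiding colour \<open>a\<close>, its edges to colour \<open>a\<close> are cut by all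
  three pairings and its other edges by one.\<close>

lemma heavy_bisection_of_colouring_minus:
  assumes z: "z \<in> V" and f: "proper_on (V - {z}) f" "sizes (V - {z}) f a (k + 1) k"
    and V: "card V = 4 * k + 2"
    and H: "H \<subseteq> N z" "f ` H \<subseteq> {a}" "(\<Sum>x\<in>N z. w {z, x}) \<le> 2 * (\<Sum>x\<in>H. w {z, x})"
  shows "\<exists>X Y. bisection V X Y \<and> bisection_weight E w X Y \<ge> 2 / 3 * total_weight E w"
proof (rule heavy_bisection_by_averaging[where B = "UNIV - {a}"
        and X = "\<lambda>b. {x \<in> V - {z}. f x \<in> {a, b}}"])
  let ?n = "\<lambda>e. card {b \<in> UNIV - {a}. separates {x \<in> V - {z}. f x \<in> {a, b}} e}"
  let ?H = "(\<lambda>x. {z, x}) ` H"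
  show "card (UNIV - {a}) = 3" using card_colours by (simp add: card_Diff_subset)
  show "bisection V {x \<in> V - {z}. f x \<in> {a, b}} (V - {x \<in> V - {z}. f x \<in> {a, b}})"
    if "b \<in> UNIV - {a}" for b
    using card_pair[OF _ f(2), of b] finite_V V that by (intro bisection_if_card) auto
  \<comment> \<open>A lower bound only: 2 away from \<open>z\<close>, 1 at \<open>z\<close>, 3 from
    \<open>z\<close> to \<open>H\<close>. A neighbour outside \<open>H\<close> may happen to have
    colour \<open>a\<close> too.\<close>
  have n: "2 - (if z \<in> e then 1 else 0) + (if e \<in> ?H then 2 else 0) \<le> real (?n e)" if e: "e \<in> E" for e
  proof (cases "z \<in> e")
    case True
    with e have "e \<in> (\<lambda>x. {z, x}) ` N z" using incident_edges by blast
    then obtain x where x: "e = {z, x}" "x \<in> N z" by blast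
    have xV: "x \<in> V" "x \<noteq> z" using x N_subset N_irrefl by auto
    have "?n e = card {b \<in> UNIV - {a}. f x \<in> {a, b}}"
      using x xV z by (simp add: separates_iff)
    also have "\<dots> = (if f x = a then 3 else 1)" by (rule card_pairings_with)
    finally have "?n e = (if f x = a then 3 else 1)" .
    moreover have "f x = a" if "e \<in> ?H" using that H(2) x xV by (auto simp: doubleton_eq_iff)
    ultimately show ?thesis using True by auto
  next
    case False
    from e obtain x y where xy: "e = {x, y}" "x \<in> V" "y \<in> V" "y \<in> N x" by (rule edgeE)
    have ne: "x \<noteq> z" "y \<noteq> z" using False xy(1) by auto
    then have "f x \<noteq> f y" using f(1) xy by (auto simp: proper_on_def)
    from card_pairings[OF this, of a] have "?n e = 2" using xy ne by (simp add: separates_iff)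
    then show ?thesis using False by auto
  qed
  have HE: "?H \<subseteq> E" using H(1) by (auto simp: N_def)
  have "2 * (\<Sum>e\<in>E. w e)
      \<le> 2 * (\<Sum>e\<in>E. w e) - (\<Sum>e | e \<in> E \<and> z \<in> e. w e) + 2 * (\<Sum>e\<in>?H. w e)"
    using H(3) by (simp add: sum_incident sum.reindex inj_on_doubleton)
  also have "\<dots> = (\<Sum>e\<in>E. w e * (2 - (if z \<in> e then 1 else 0) + (if e \<in> ?H then 2 else 0)))"
  proof -
    have "(\<Sum>e | e \<in> E \<and> z \<in> e. w e) = (\<Sum>e\<in>E. w e * (if z \<in> e then 1 else 0))"
      using finite_E by (simp add: sum.inter_filter if_distrib cong: if_cong)
    moreover have "(\<Sum>e\<in>?H. w e) = (\<Sum>e | e \<in> E \<and> e \<in> ?H. w e)"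
      by (rule sum.cong) (use HE in auto)
    then have "2 * (\<Sum>e\<in>?H. w e) = (\<Sum>e\<in>E. w e * (if e \<in> ?H then 2 else 0))"
      using finite_E by (simp add: sum.inter_filter sum_distrib_left if_distrib mult.commute cong: if_cong)
    ultimately show ?thesis
      by (simp only: distrib_left right_diff_distrib sum.distrib sum_subtractf sum_distrib_left sum_distrib_right
          mult.commute)
  qed
  also have "\<dots> \<le> (\<Sum>e\<in>E. w e * ?n e)"
    by (intro sum_mono mult_left_mono n w_nonneg)
  finally show "2 * (\<Sum>e\<in>E. w e) \<le> (\<Sum>e\<in>E. w e * ?n e)" .
qed

section \<open>Equitable colourings of vertex subsets\<close>

lemma equitable_colouring_subset:
  assumes "W \<subseteq> V" "card W = 4 * k"
  obtains f where "proper_on W f" "sizes W f a k k"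
proof -
  interpret near_subcubic W "\<lambda>x y. y \<in> N x" undefined
  proof
    show "card {y \<in> W. y \<in> N x} \<le> (if x = undefined then 4 else 3)" if "x \<in> W" for x
    proof -
      have "card {y \<in> W. y \<in> N x} \<le> card (N x)" by (rule card_mono) auto
      then show ?thesis using card_N_le[of x] that assms(1) by auto
    qed
  qed (use assms finite_V N_sym N_irrefl in \<open>auto intro: finite_subset\<close>)
  obtain f :: "'a \<Rightarrow> bool \<times> bool" where "balanced k f"
    using balanced_colouring_exists[OF card_colours assms(2)] by blast
  then have "proper_on W f" "sizes W f a k k"
    by (auto simp: balanced_def proper_def cls_def proper_on_def sizes_def)
  then show ?thesis by (rule that)
qed

lemma sizes_insert:
  assumes "finite W" "sizes W f a k k" "v \<notin> W"
  shows "sizes (insert v W) (f(v := c)) c (k + 1) k"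
  unfolding sizes_def
proof
  fix d
  have "{x \<in> insert v W. (f(v := c)) x = d}
      = (if d = c then insert v {x \<in> W. f x = d} else {x \<in> W. f x = d})"
    using assms(3) by auto
  then show "card {x \<in> insert v W. (f(v := c)) x = d} = (if d = c then k + 1 else k)"
    using assms(1,3) sizesD[OF assms(2), of d] by (cases "d = c") simp_all
qed

lemma proper_on_insert:
  assumes "proper_on W f" "\<And>y. y \<in> W \<Longrightarrow> y \<in> N v \<Longrightarrow> f y \<noteq> c" "v \<notin> W"
  shows "proper_on (insert v W) (f(v := c))"
  unfolding proper_on_def
proof (intro ballI impI)
  fix x y assume "x \<in> insert v W" "y \<in> insert v W" and yx: "y \<in> N x"
  moreover have "x \<noteq> y" "x \<in> N y" using yx N_irrefl N_sym by metis+
  ultimately show "(f(v := c)) x \<noteq> (f(v := c)) y"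
    using assms unfolding proper_on_def by (auto; metis)
qed

text \<open>Three neighbours cannot use up four colours, so one is free for \<open>v\<close>; its
  class becomes the larger one.\<close>

lemma extend_colouring:
  assumes "W \<subseteq> V" "proper_on W f" "sizes W f a k k" "v \<in> V" "v \<notin> W"
  obtains c where "proper_on (insert v W) (f(v := c))" "sizes (insert v W) (f(v := c)) c (k + 1) k"
proof -
  have "card (f ` N v) \<le> 3"
    using card_image_le[OF finite_N, of f v] card_N_le[OF assms(4)] by simp
  then have "f ` N v \<noteq> UNIV" using card_colours by auto
  then obtain c where c: "c \<notin> f ` N v" by blast
  show ?thesis
  proof (rule that)
    show "proper_on (insert v W) (f(v := c))"
      using c by (intro proper_on_insert[OF assms(2) _ assms(5)]) auto
    show "sizes (insert v W) (f(v := c)) c (k + 1) k"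
      using sizes_insert[OF _ assms(3,5)] assms(1) finite_V finite_subset by blast
  qed
qed

section \<open>The number of vertices modulo four\<close>

lemma heavy_bisection_mod4_0:
  assumes "card V = 4 * k"
  shows "\<exists>X Y. bisection V X Y \<and> bisection_weight E w X Y \<ge> 2 / 3 * total_weight E w"
proof -
  obtain f where "proper_on V f" "sizes V f undefined k k"
    using equitable_colouring_subset[OF order.refl assms] .
  then show ?thesis by (rule heavy_bisection_of_colouring) (use assms in auto)
qed

lemma heavy_bisection_mod4_1:
  assumes "card V = 4 * k + 1"
  shows "\<exists>X Y. bisection V X Y \<and> bisection_weight E w X Y \<ge> 2 / 3 * total_weight E w"
proof -
  obtain v where v: "v \<in> V" using assms by fastforce
  have "card (V - {v}) = 4 * k" using assms v finite_V by simp
  then obtain f where f: "proper_on (V - {v}) f" "sizes (V - {v}) f undefined k k"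
    using equitable_colouring_subset[of "V - {v}" k] by blast
  have ins: "insert v (V - {v}) = V" using v by auto
  obtain c where "proper_on V (f(v := c))" "sizes V (f(v := c)) c (k + 1) k"
    using extend_colouring[OF _ f v] unfolding ins by blast
  then show ?thesis by (rule heavy_bisection_of_colouring) (use assms in auto)
qed

text \<open>An additional isolated vertex \<open>None\<close> makes the number of vertices divisible by four.\<close>

lemma heavy_bisection_mod4_3:
  assumes "card V = 4 * k + 3"
  shows "\<exists>X Y. bisection V X Y \<and> bisection_weight E w X Y \<ge> 2 / 3 * total_weight E w"
proof -
  note finV = finite_V
  let ?V = "insert None (Some ` V)"
  let ?R = "\<lambda>x y. \<exists>u v. x = Some u \<and> y = Some v \<and> v \<in> N u"
  interpret near_subcubic ?V ?R None
  proof
    show "card {y \<in> ?V. ?R x y} \<le> (if x = None then 4 else 3)" if x: "x \<in> ?V" for x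
    proof (cases x)
      case (Some u)
      have "card {y \<in> ?V. ?R x y} \<le> card (Some ` N u)" by (rule card_mono) (auto simp: Some)
      also have "\<dots> = card (N u)" by (rule card_image) simp
      finally show ?thesis using card_N_le[of u] x Some by auto
    qed auto
  qed (auto simp: finite_V N_irrefl dest: N_sym[THEN iffD1])
  have "card ?V = 4 * (k + 1)" using assms finV by (simp add: card_image)
  then obtain f :: "'a option \<Rightarrow> bool \<times> bool" where f: "balanced (k + 1) f"
    using balanced_colouring_exists[OF card_colours] by blast
  let ?f = "\<lambda>v. f (Some v)"
  have "proper_on V ?f"
    using f unfolding balanced_def proper_def proper_on_def by blast
  \<comment> \<open>Removing \<open>None\<close> leaves its class with \<open>k\<close> vertices and
    the other three with \<open>k + 1\<close>.\<close>
  moreover have "sizes V ?f (f None) k (k + 1)"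
    unfolding sizes_def
  proof
    fix c
    have "card (cls f c) = k + 1" using f unfolding balanced_def by blast
    moreover have "cls f c = (if c = f None then insert None (Some ` {x \<in> V. ?f x = c})
        else Some ` {x \<in> V. ?f x = c})"
      by (auto simp: cls_def)
    ultimately show "card {x \<in> V. ?f x = c} = (if c = f None then k else k + 1)"
      using finV by (auto simp: card_image card_insert_if split: if_splits)
  qed
  ultimately show ?thesis by (rule heavy_bisection_of_colouring) (use assms in auto)
qed

text \<open>Adding \<open>a\<close> last to an equitable colouring of the rest makes its class the
  larger one. Admitting a non-neighbour \<open>a\<close> covers isolated \<open>z\<close>, where
  \<open>heavy\<close> reads 0 \<le> 0.\<close>

lemma heavy_bisection_heavy_neighbour:
  assumes V: "card V = 4 * k + 2" and z: "z \<in> V" and a: "a \<in> V" "a \<noteq> z"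
    and heavy: "(\<Sum>x\<in>N z. w {z, x}) \<le> 2 * (if a \<in> N z then w {z, a} else 0)"
  shows "\<exists>X Y. bisection V X Y \<and> bisection_weight E w X Y \<ge> 2 / 3 * total_weight E w"
proof -
  let ?W = "V - {z, a}"
  have "card ?W = 4 * k" using V z a finite_V by (simp add: card_Diff_subset)
  then obtain f where f: "proper_on ?W f" "sizes ?W f undefined k k"
    using equitable_colouring_subset[of ?W k] by blast
  have ins: "insert a ?W = V - {z}" using a by auto
  obtain c where "proper_on (V - {z}) (f(a := c))" "sizes (V - {z}) (f(a := c)) c (k + 1) k"
    using extend_colouring[OF _ f a(1)] unfolding ins by blast
  moreover have "(\<Sum>x\<in>N z \<inter> {a}. w {z, x}) = (if a \<in> N z then w {z, a} else 0)"
    by (cases "a \<in> N z") auto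
  ultimately show ?thesis
    by (intro heavy_bisection_of_colouring_minus[OF z _ _ V, where H = "N z \<inter> {a}"])
      (use heavy in auto)
qed

text \<open>Merging the non-adjacent vertices \<open>a\<close> and \<open>b\<close> forces them to have the same colour. The merged
  vertex is the one vertex whose degree may be four.\<close>

lemma heavy_bisection_nonadjacent_neighbours:
  assumes V: "card V = 4 * k + 2" and z: "z \<in> V" and ab: "a \<in> N z" "b \<in> N z" "a \<noteq> b" "b \<notin> N a"
    and heavy: "(\<Sum>x\<in>N z. w {z, x}) \<le> 2 * (w {z, a} + w {z, b})"
  shows "\<exists>X Y. bisection V X Y \<and> bisection_weight E w X Y \<ge> 2 / 3 * total_weight E w"
proof -
  note finV = finite_V
  let ?W = "V - {z, b}"
  let ?R = "\<lambda>x y. y \<in> N x \<or> x = a \<and> y \<in> N b \<or> y = a \<and> x \<in> N b"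
  have V': "a \<in> V" "b \<in> V" and zz: "a \<noteq> z" "b \<noteq> z" "z \<in> N a" "z \<in> N b"
    using ab N_subset N_irrefl N_sym by auto
  have ba: "a \<notin> N b" using ab(4) N_sym by simp
  interpret near_subcubic ?W ?R a
  proof
    show "card {y \<in> ?W. ?R x y} \<le> (if x = a then 4 else 3)" if x: "x \<in> ?W" for x
    proof -
      \<comment> \<open>With \<open>z\<close> removed, the merged vertex has at most 2 + 2
        neighbours; a neighbour of \<open>b\<close> trades \<open>b\<close> for \<open>a\<close>;
        all others keep their neighbours.\<close>
      consider "x = a" | "x \<noteq> a" "x \<in> N b" | "x \<noteq> a" "x \<notin> N b" by blast
      then show ?thesis
      proof cases
        case 1
        have "card {y \<in> ?W. ?R x y} \<le> card ((N a - {z}) \<union> (N b - {z}))"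
          by (rule card_mono) (use 1 ba in auto)
        also have "\<dots> \<le> card (N a - {z}) + card (N b - {z})" by (rule card_Un_le)
        also have "\<dots> \<le> 4" using card_N_le[OF V'(1)] card_N_le[OF V'(2)] zz by simp
        finally show ?thesis using 1 by simp
      next
        case 2
        have "b \<in> N x" using 2 N_sym by simp
        have "card {y \<in> ?W. ?R x y} \<le> card (insert a (N x - {b}))"
          by (rule card_mono) (use 2 in auto)
        also have "\<dots> \<le> card (N x - {b}) + 1" by (simp add: card_insert_if)
        also have "\<dots> \<le> 3" using card_N_le[of x] x \<open>b \<in> N x\<close> by simp
        finally show ?thesis using 2 by simp
      next
        case 3
        have "card {y \<in> ?W. ?R x y} \<le> card (N x)" by (rule card_mono) (use 3 in auto)
        then show ?thesis using card_N_le[of x] x 3 by simp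
      qed
    qed
  qed (use finite_V ba in \<open>auto simp: N_irrefl dest: N_sym[THEN iffD1]\<close>)
  have "card ?W = 4 * k" using V z V' zz finV by (simp add: card_Diff_subset)
  then obtain f :: "'a \<Rightarrow> bool \<times> bool" where f: "balanced k f"
    using balanced_colouring_exists[OF card_colours] by blast
  have ins: "insert b ?W = V - {z}" using V' zz by auto
  let ?f = "f(b := f a)"
  have "proper_on ?W f"
    using f unfolding balanced_def proper_def proper_on_def by blast
  then have "proper_on (insert b ?W) ?f"
  proof (rule proper_on_insert)
    show "f y \<noteq> f a" if "y \<in> ?W" "y \<in> N b" for y
    proof -
      have "a \<in> ?W" using V' zz ab by auto
      with f that have "f a \<noteq> f y" unfolding balanced_def proper_def by blast
      then show ?thesis by simp
    qed
  qed simp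
  then have "proper_on (V - {z}) ?f" by (simp only: ins)
  moreover have "sizes (insert b ?W) ?f (f a) (k + 1) k"
    by (rule sizes_insert[where a = undefined])
      (use f finV in \<open>auto simp: balanced_def cls_def sizes_def\<close>)
  then have "sizes (V - {z}) ?f (f a) (k + 1) k" by (simp only: ins)
  ultimately show ?thesis
    by (rule heavy_bisection_of_colouring_minus[OF z _ _ V, where H = "{a, b}"])
      (use heavy ab in auto)
qed

text \<open>If all neighbourhoods are triangles, the closed neighbourhoods partition the graph into
  copies of \<open>K\<^sub>4\<close>.\<close>

lemma four_dvd_card_if_cliques:
  assumes N3: "\<And>z. z \<in> V \<Longrightarrow> card (N z) = 3"
    and clique: "\<And>z a b. z \<in> V \<Longrightarrow> a \<in> N z \<Longrightarrow> b \<in> N z \<Longrightarrow> a \<noteq> b \<Longrightarrow> b \<in> N a"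
  shows "4 dvd card V"
proof -
  let ?K = "\<lambda>z. insert z (N z)"
  have K4: "card (?K z) = 4" if "z \<in> V" for z using N3[OF that] N_irrefl by simp
  have same: "?K z = ?K x" if z: "z \<in> V" and x: "x \<in> ?K z" for x z
  proof -
    have "x \<in> V" using z x N_subset by auto
    have "?K z \<subseteq> ?K x"
    proof
      fix y assume "y \<in> ?K z"
      then show "y \<in> ?K x" using x clique[OF z, of x y] N_sym[of x z] by auto
    qed
    then show ?thesis using K4[OF z] K4[OF \<open>x \<in> V\<close>] by (intro card_subset_eq) auto
  qed
  have U: "\<Union> (?K ` V) = V" using N_subset by auto
  have "4 dvd card (\<Union> (?K ` V))"
  proof (rule dvd_partition)
    show "finite (\<Union> (?K ` V))" using U finite_V by simp
    show "\<forall>c\<in>?K ` V. 4 dvd card c" using K4 by auto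
    show "\<forall>c1\<in>?K ` V. \<forall>c2\<in>?K ` V. c1 \<noteq> c2 \<longrightarrow> c1 \<inter> c2 = {}" using same by blast
  qed
  then show ?thesis by (simp only: U)
qed

text \<open>If some \<open>z\<close> has degree at most two, a heaviest edge at \<open>z\<close>
  carries half of its weight. If some \<open>z\<close> has non-adjacent neighbours \<open>a\<close>
  and \<open>b\<close> and a third one \<open>c\<close>, then either \<open>c\<close> alone or
  \<open>a\<close> and \<open>b\<close> together carry half. Otherwise \<open>V\<close> splits into
  copies of \<open>K\<^sub>4\<close>, against \<open>card V mod 4 = 2\<close>.\<close>

lemma heavy_bisection_mod4_2:
  assumes V: "card V = 4 * k + 2"
  shows "\<exists>X Y. bisection V X Y \<and> bisection_weight E w X Y \<ge> 2 / 3 * total_weight E w"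
proof -
  note heavy1 = heavy_bisection_heavy_neighbour[OF V]
  consider (small) z where "z \<in> V" "card (N z) \<le> 2"
    | (big) z a b where "z \<in> V" "card (N z) = 3" "a \<in> N z" "b \<in> N z" "a \<noteq> b" "b \<notin> N a"
    | (cliques) "\<And>z. z \<in> V \<Longrightarrow> card (N z) = 3"
      "\<And>z a b. z \<in> V \<Longrightarrow> a \<in> N z \<Longrightarrow> b \<in> N z \<Longrightarrow> a \<noteq> b \<Longrightarrow> b \<in> N a"
  proof -
    have "card (N z) = 3" if "\<not> card (N z) \<le> 2" "z \<in> V" for z
      using card_N_le[OF that(2)] that(1) by simp
    then show ?thesis using that by metis
  qed
  then show ?thesis
  proof cases
    case small
    have nbr: "x \<in> V" "x \<noteq> z" if "x \<in> N z" for x using that N_subset N_irrefl by auto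
    consider "card (N z) = 0" | "card (N z) = 1" | "card (N z) = 2" using small(2) by linarith
    then show ?thesis
    proof cases
      case 1
      then have N: "N z = {}" by simp
      have "V \<noteq> {z}" using V by auto
      then obtain a where "a \<in> V" "a \<noteq> z" using small(1) by blast
      then show ?thesis using heavy1[OF small(1)] N by simp
    next
      case 2
      then obtain a where N: "N z = {a}" by (auto simp: card_1_singleton_iff)
      then have "0 \<le> w {z, a}" using w_nonneg by (auto simp: N_def)
      then show ?thesis using heavy1[OF small(1) nbr[of a]] N by simp
    next
      case 3
      then obtain a b where N: "N z = {a, b}" "a \<noteq> b" by (auto simp: card_2_iff)
      show ?thesis
      proof (cases "w {z, a} \<le> w {z, b}")
        case True
        then show ?thesis using heavy1[OF small(1) nbr[of b]] N by simp
      next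
        case False
        then show ?thesis using heavy1[OF small(1) nbr[of a]] N by simp
      qed
    qed
  next
    case big
    have "card (N z - {a, b}) = 1" using big by (simp add: card_Diff_subset)
    then obtain c where c: "N z - {a, b} = {c}" by (auto simp: card_1_singleton_iff)
    then have N: "N z = {a, b, c}" "c \<noteq> a" "c \<noteq> b" using big by auto
    then have sum: "(\<Sum>x\<in>N z. w {z, x}) = w {z, a} + w {z, b} + w {z, c}"
      using big(5) by simp
    have cV: "c \<in> V" "c \<noteq> z" "c \<in> N z" using N N_subset[of z] N_irrefl[of z] by auto
    show ?thesis
    proof (cases "w {z, a} + w {z, b} \<le> w {z, c}")
      case True
      then show ?thesis using heavy1[OF big(1) cV(1,2)] cV(3) sum by simp
    next
      case False
      then show ?thesis
        using heavy_bisection_nonadjacent_neighbours[OF V big(1,3-6)] sum by simp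
    qed
  next
    case cliques
    then have "4 dvd card V" by (rule four_dvd_card_if_cliques)
    then show ?thesis using V by presburger
  qed
qed

end

theorem theorem3p4:
  fixes V :: "'a set" and E :: "'a set set" and w :: "'a set \<Rightarrow> real"
  assumes "weighted_graph V E w"
    and "\<forall>v\<in>V. degree E v \<le> 3"
  shows "\<exists>X Y. bisection V X Y \<and> bisection_weight E w X Y \<ge> 2 / 3 * total_weight E w"
proof -
  interpret weighted_graph V E w by (rule assms(1))
  interpret weighted_subcubic V E w by unfold_locales (use assms(2) in blast)
  define k where "k = card V div 4"
  have "card V = 4 * k \<or> card V = 4 * k + 1 \<or> card V = 4 * k + 2 \<or> card V = 4 * k + 3"
    unfolding k_def by presburger
  then show ?thesis
    using heavy_bisection_mod4_0 heavy_bisection_mod4_1 heavy_bisection_mod4_2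
      heavy_bisection_mod4_3 by blast
qed

end
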